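(* Let $(X,m)$ be a measure space and let $T:D(T)\subseteq L^2(X,m)\longrightarrow L^2(X,m)$ be a densely defined symmetric operator such that every function $f\in\ker\overline{T}$ is constant. (1) If $T$ is essentially self-adjoint, then $T$ satisfies the $L^2$-Liouville property. (2) If $T$ satisfies the $L^2$-Liouville property, $T$ is strictly positive and $m(X)=\infty$, then $T$ is essentially self-adjoint.
   Context: For a densely defined symmetric operator $T$ on a Hilbert space, $T^*$ denotes the adjoint and $\overline{T}=T^{**}$ the closure of $T$. Symmetric operators are always assumed to have dense domain. $T$ is essentially self-adjoint if $\overline{T}$ is self-adjoint (equivalently, $T$ has a unique self-adjoint extension). $T$ is strictly positive if there is a constant $C>0$ such that $\langle Tf,f\rangle\ge C\|f\|^2$ for all $f\in D(T)$. When the Hilbert space is $L^2(X,m)$, $T$ satisfies the $L^2$-Liouville property if every function $f\in\ker T^*$ is constant. Here "constant" means equal $m$-almost everywhere to a constant function. *)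

theory Defs
  imports "HOL-Analysis.Analysis"
begin

text \<open>
  The scalar field of the Hilbert space. A commutative, finite-dimensional real normed field with
  multiplicative norm and an additive involution satisfying \<open>z * conj z = \<bar>z\<bar>\<^sup>2\<close> is
  (isomorphic to) the reals or the complex numbers with the usual conjugation, so real and complex
  \<open>L\<^sup>2\<close> spaces are treated simultaneously.
\<close>

class real_or_complex = real_normed_field + euclidean_space +
  fixes conj :: "'a \<Rightarrow> 'a"
  assumes conj_add: "conj (x + y) = conj x + conj y"
    and mult_conj: "x * conj x = (norm x)\<^sup>2 *\<^sub>R 1"

instantiation real :: real_or_complex
begin

definition conj_real :: "real \<Rightarrow> real" where "conj_real x = x"

instance by standard (auto simp: conj_real_def power2_eq_square)

end

instantiation complex :: real_or_complex
begin

definition conj_complex :: "complex \<Rightarrow> complex" where "conj_complex = cnj"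

instance by standard
  (simp_all add: conj_complex_def complex_norm_square [symmetric] scaleR_conv_of_real)

end

text \<open>
  Elements of \<open>L\<^sup>2(X,m)\<close> are represented by square-integrable measurable functions, and subsets of
  \<open>L\<^sup>2\<close> and of \<open>L\<^sup>2 \<times> L\<^sup>2\<close> by sets of representatives that are closed under almost everywhere
  equality. Thus equality of such sets of representatives is equality of the represented sets.
\<close>

definition L2 :: "'a measure \<Rightarrow> ('a \<Rightarrow> 'k::real_or_complex) set" where
  "L2 M = {f \<in> borel_measurable M. integrable M (\<lambda>x. (norm (f x))\<^sup>2)}"

definition l2_inner :: "'a measure \<Rightarrow> ('a \<Rightarrow> 'k) \<Rightarrow> ('a \<Rightarrow> 'k) \<Rightarrow> 'k::real_or_complex" where
  "l2_inner M f g = (\<integral>x. f x * conj (g x) \<partial>M)"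

definition l2_norm :: "'a measure \<Rightarrow> ('a \<Rightarrow> 'k::real_or_complex) \<Rightarrow> real" where
  "l2_norm M f = sqrt (\<integral>x. (norm (f x))\<^sup>2 \<partial>M)"

definition ae_constant :: "'a measure \<Rightarrow> ('a \<Rightarrow> 'k) \<Rightarrow> bool" where
  "ae_constant M f \<longleftrightarrow> (\<exists>c. AE x in M. f x = c)"

text \<open>Operators are identified with their graphs; \<open>Domain T\<close> is the domain \<open>D(T)\<close>.\<close>

type_synonym ('a, 'k) l2_graph = "(('a \<Rightarrow> 'k) \<times> ('a \<Rightarrow> 'k)) set"

definition l2_operator :: "'a measure \<Rightarrow> ('a, 'k::real_or_complex) l2_graph \<Rightarrow> bool" where
  "l2_operator M T \<longleftrightarrow>
     T \<subseteq> L2 M \<times> L2 M \<and>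
     (\<forall>(f, g) \<in> T. \<forall>f' \<in> L2 M. \<forall>g' \<in> L2 M.
        (AE x in M. f' x = f x) \<and> (AE x in M. g' x = g x) \<longrightarrow> (f', g') \<in> T) \<and>
     (\<forall>f g g'. (f, g) \<in> T \<and> (f, g') \<in> T \<longrightarrow> (AE x in M. g x = g' x)) \<and>
     (\<lambda>_. 0, \<lambda>_. 0) \<in> T \<and>
     (\<forall>(f, g) \<in> T. \<forall>(f', g') \<in> T. (\<lambda>x. f x + f' x, \<lambda>x. g x + g' x) \<in> T) \<and>
     (\<forall>c. \<forall>(f, g) \<in> T. (\<lambda>x. c * f x, \<lambda>x. c * g x) \<in> T)"

definition densely_defined :: "'a measure \<Rightarrow> ('a, 'k::real_or_complex) l2_graph \<Rightarrow> bool" where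
  "densely_defined M T \<longleftrightarrow>
     (\<forall>f \<in> L2 M. \<forall>e > 0. \<exists>h \<in> Domain T. l2_norm M (\<lambda>x. f x - h x) < e)"

definition symmetric_operator :: "'a measure \<Rightarrow> ('a, 'k::real_or_complex) l2_graph \<Rightarrow> bool" where
  "symmetric_operator M T \<longleftrightarrow>
     l2_operator M T \<and> densely_defined M T \<and>
     (\<forall>(f, Tf) \<in> T. \<forall>(g, Tg) \<in> T. l2_inner M Tf g = l2_inner M f Tg)"

definition l2_adjoint ::
  "'a measure \<Rightarrow> ('a, 'k::real_or_complex) l2_graph \<Rightarrow> ('a, 'k) l2_graph" where
  "l2_adjoint M T =
     {(g, h). g \<in> L2 M \<and> h \<in> L2 M \<and> (\<forall>(f, Tf) \<in> T. l2_inner M Tf g = l2_inner M f h)}"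

definition l2_closure ::
  "'a measure \<Rightarrow> ('a, 'k::real_or_complex) l2_graph \<Rightarrow> ('a, 'k) l2_graph" where
  "l2_closure M T = l2_adjoint M (l2_adjoint M T)"

definition self_adjoint :: "'a measure \<Rightarrow> ('a, 'k::real_or_complex) l2_graph \<Rightarrow> bool" where
  "self_adjoint M T \<longleftrightarrow> l2_operator M T \<and> densely_defined M T \<and> l2_adjoint M T = T"

definition essentially_self_adjoint ::
  "'a measure \<Rightarrow> ('a, 'k::real_or_complex) l2_graph \<Rightarrow> bool" where
  "essentially_self_adjoint M T \<longleftrightarrow> self_adjoint M (l2_closure M T)"

definition l2_kernel :: "('a, 'k::real_or_complex) l2_graph \<Rightarrow> ('a \<Rightarrow> 'k) set" where
  "l2_kernel T = {f. (f, \<lambda>_. 0) \<in> T}"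

text \<open>
  The inequality \<open>\<langle>Tf, f\<rangle> \<ge> C \<parallel>f\<parallel>\<^sup>2\<close> between scalars includes that \<open>\<langle>Tf, f\<rangle>\<close> is real, which is
  automatic for symmetric \<open>T\<close>.
\<close>

definition strictly_positive :: "'a measure \<Rightarrow> ('a, 'k::real_or_complex) l2_graph \<Rightarrow> bool" where
  "strictly_positive M T \<longleftrightarrow>
     (\<exists>C > 0. \<forall>(f, Tf) \<in> T. \<exists>r. l2_inner M Tf f = of_real r \<and> r \<ge> C * (l2_norm M f)\<^sup>2)"

definition l2_liouville :: "'a measure \<Rightarrow> ('a, 'k::real_or_complex) l2_graph \<Rightarrow> bool" where
  "l2_liouville M T \<longleftrightarrow> (\<forall>f \<in> l2_kernel (l2_adjoint M T). ae_constant M f)"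

end

theory Submission
  imports Defs
begin

text \<open>
  For symmetric \<open>T\<close> one has \<open>T** \<subseteq> T*\<close>, and \<open>T\<close> is essentially self-adjoint iff equality holds,
  which gives (1). For (2), square-integrability and \<open>m(X) = \<infinity>\<close> turn the Liouville property into
  \<open>ker T* = {0}\<close>. Given \<open>(g, h) \<in> T*\<close>, strict positivity yields \<open>(f, k) \<in> T**\<close> with \<open>h - k\<close>
  orthogonal to the range of \<open>T\<close>, that is \<open>h - k \<in> ker T*\<close>; so \<open>h = k\<close>, hence \<open>g - f \<in> ker T*\<close>,
  and \<open>(g, h) = (f, k)\<close> lies in \<open>T**\<close>.
\<close>

section \<open>The scalar field\<close>

lemma conj_zero [simp]: "conj (0::'k::real_or_complex) = 0"
  using conj_add[of 0 "0::'k"] by simp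

lemma mult_conj_of_real: "x * conj x = of_real ((norm x)\<^sup>2)" for x :: "'k::real_or_complex"
  by (simp add: mult_conj of_real_def)

text \<open>The axiom \<open>mult_conj\<close> determines \<open>conj\<close> by division; at 0 both
  sides vanish because division by zero yields 0. Multiplicativity, isometry and involutivity then
  follow by field arithmetic.\<close>

lemma conj_eq_divide: "conj x = of_real ((norm x)\<^sup>2) / x" for x :: "'k::real_or_complex"
  by (cases "x = 0") (simp_all add: mult_conj_of_real[symmetric] del: of_real_power)

lemma conj_mult: "conj (x * y) = conj x * conj y" for x y :: "'k::real_or_complex"
  by (simp add: conj_eq_divide norm_mult power_mult_distrib)

lemma norm_conj [simp]: "norm (conj x) = norm x" for x :: "'k::real_or_complex"
  by (cases "x = 0") (simp_all add: conj_eq_divide norm_divide norm_mult power2_eq_square)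

lemma conj_of_real [simp]: "conj (of_real r :: 'k::real_or_complex) = of_real r"
  by (cases "r = 0") (simp_all add: conj_eq_divide power2_eq_square)

lemma conj_one [simp]: "conj (1::'k::real_or_complex) = 1"
  using conj_of_real[of 1] by simp

lemma conj_minus [simp]: "conj (- x) = - conj x" for x :: "'k::real_or_complex"
  by (simp add: conj_eq_divide)

lemma conj_conj [simp]: "conj (conj x) = x" for x :: "'k::real_or_complex"
proof (cases "x = 0")
  case False
  then have "conj x \<noteq> 0"
    by (metis norm_conj norm_eq_zero)
  then have "conj (conj x) = of_real ((norm x)\<^sup>2) / conj x"
    by (simp add: conj_eq_divide[of "conj x"])
  also have "\<dots> = x"
    using \<open>conj x \<noteq> 0\<close> by (simp add: mult_conj_of_real[symmetric] del: of_real_power)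
  finally show ?thesis .
qed simp

section \<open>Continuity of the conjugation and the real inner product\<close>

lemma bounded_linear_conj: "bounded_linear (conj :: 'k::real_or_complex \<Rightarrow> 'k)"
proof (rule bounded_linear_intro[where K = 1])
  show "conj (r *\<^sub>R x) = r *\<^sub>R conj x" for r and x :: 'k
    by (simp add: scaleR_conv_of_real conj_mult)
qed (simp_all add: conj_add)

lemma measurable_conj [measurable]: "conj \<in> borel_measurable (borel :: 'k::real_or_complex measure)"
  by (intro borel_measurable_continuous_onI linear_continuous_on bounded_linear_conj)

text \<open>Polarization: the square of \<open>norm (x + y)\<close> is expanded once with the
  Euclidean inner product and once with \<open>mult_conj\<close>. This links two structures that the
  class relates only through the norm.\<close>

lemma of_real_inner: "of_real (2 * inner x y) = x * conj y + y * conj x"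
  for x y :: "'k::real_or_complex"
proof -
  have "(norm (x + y))\<^sup>2 = (norm x)\<^sup>2 + (norm y)\<^sup>2 + 2 * inner x y"
    by (simp add: power2_norm_eq_inner inner_add_left inner_add_right inner_commute)
  then have "of_real (2 * inner x y) = (of_real ((norm (x + y))\<^sup>2)
      - of_real ((norm x)\<^sup>2) - of_real ((norm y)\<^sup>2) :: 'k)"
    by simp
  also have "\<dots> = x * conj y + y * conj x"
    unfolding mult_conj_of_real[symmetric] by (simp add: conj_add algebra_simps)
  finally show ?thesis .
qed

text \<open>Here \<open>inner z 1\<close> serves as the real part of \<open>z\<close>. The
  right-hand side of \<open>of_real_inner\<close> does not change when \<open>x\<close> and
  \<open>y\<close> are replaced by \<open>x * conj y\<close> and \<open>1\<close>.\<close>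

lemma inner_eq_inner_one: "inner x y = inner (x * conj y) 1" for x y :: "'k::real_or_complex"
proof -
  have "of_real (2 * inner x y) = (of_real (2 * inner (x * conj y) 1) :: 'k)"
    unfolding of_real_inner by (simp add: conj_mult mult.commute)
  then show ?thesis
    by (simp only: of_real_eq_iff)
qed

lemma inner_of_real_one: "inner (of_real r) (1::'k::real_or_complex) = r"
  by (simp add: of_real_def norm_eq_1[symmetric])

section \<open>The space \<open>L2\<close>\<close>

context
  fixes M :: "'a measure"
begin

lemma L2_D:
  assumes "f \<in> L2 M"
  shows "f \<in> borel_measurable M" "integrable M (\<lambda>x. (norm (f x))\<^sup>2)"
  using assms by (auto simp: L2_def)

lemma L2_zero: "(\<lambda>_. 0) \<in> L2 M"
  by (simp add: L2_def)

lemma L2_mult: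
  fixes f :: "'a \<Rightarrow> 'k::real_or_complex"
  assumes "f \<in> L2 M"
  shows "(\<lambda>x. c * f x) \<in> L2 M"
  using L2_D[OF assms] by (simp add: L2_def norm_mult power_mult_distrib)

lemma L2_add:
  fixes f g :: "'a \<Rightarrow> 'k::real_or_complex"
  assumes f: "f \<in> L2 M" and g: "g \<in> L2 M"
  shows "(\<lambda>x. f x + g x) \<in> L2 M"
proof -
  note [measurable] = L2_D(1)[OF f] L2_D(1)[OF g]
  have bound: "(norm (a + b))\<^sup>2 \<le> 2 * (norm a)\<^sup>2 + 2 * (norm b)\<^sup>2" for a b :: 'k
  proof -
    have "(norm (a + b))\<^sup>2 \<le> (norm a + norm b)\<^sup>2"
      by (intro power_mono norm_triangle_ineq) simp
    also have "\<dots> \<le> 2 * (norm a)\<^sup>2 + 2 * (norm b)\<^sup>2"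
      using sum_squares_ge_zero[of "norm a - norm b" 0] by (simp add: power2_eq_square algebra_simps)
    finally show ?thesis .
  qed
  have "integrable M (\<lambda>x. 2 * (norm (f x))\<^sup>2 + 2 * (norm (g x))\<^sup>2)"
    using L2_D(2)[OF f] L2_D(2)[OF g] by simp
  then have "integrable M (\<lambda>x. (norm (f x + g x))\<^sup>2)"
    by (rule Bochner_Integration.integrable_bound) (use bound in auto)
  then show ?thesis
    by (simp add: L2_def)
qed

lemma L2_diff:
  fixes f g :: "'a \<Rightarrow> 'k::real_or_complex"
  assumes "f \<in> L2 M" "g \<in> L2 M"
  shows "(\<lambda>x. f x - g x) \<in> L2 M"
  using L2_add[OF assms(1) L2_mult[OF assms(2), of "- 1"]] by simp

lemma integrable_L2_mult_conj:
  fixes f g :: "'a \<Rightarrow> 'k::real_or_complex"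
  assumes f: "f \<in> L2 M" and g: "g \<in> L2 M"
  shows "integrable M (\<lambda>x. f x * conj (g x))"
proof -
  note [measurable] = L2_D(1)[OF f] L2_D(1)[OF g]
  have bound: "norm a * norm b \<le> (norm a)\<^sup>2 + (norm b)\<^sup>2" for a b :: 'k
    using sum_squares_bound[of "norm a" "norm b"] mult_nonneg_nonneg[OF norm_ge_zero norm_ge_zero, of a b]
    by linarith
  have "integrable M (\<lambda>x. (norm (f x))\<^sup>2 + (norm (g x))\<^sup>2)"
    using L2_D(2)[OF f] L2_D(2)[OF g] by simp
  then show ?thesis
    by (rule Bochner_Integration.integrable_bound) (use bound in \<open>auto simp: norm_mult\<close>)
qed

section \<open>Sesquilinearity of the inner product\<close>

lemma l2_inner_add_left:
  "f \<in> L2 M \<Longrightarrow> g \<in> L2 M \<Longrightarrow> h \<in> L2 M \<Longrightarrow>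
    l2_inner M (\<lambda>x. f x + g x) h = l2_inner M f h + l2_inner M g h"
  by (simp add: l2_inner_def distrib_right integrable_L2_mult_conj)

lemma l2_inner_mult_left: "l2_inner M (\<lambda>x. c * f x) g = c * l2_inner M f g"
  by (simp add: l2_inner_def mult.assoc)

lemma l2_inner_commute: "l2_inner M g f = conj (l2_inner M f g)"
  if "f \<in> L2 M" "g \<in> L2 M"
  using integral_bounded_linear[OF bounded_linear_conj integrable_L2_mult_conj[OF that]]
  by (simp add: l2_inner_def conj_mult mult.commute)

lemma l2_inner_add_right:
  "f \<in> L2 M \<Longrightarrow> g \<in> L2 M \<Longrightarrow> h \<in> L2 M \<Longrightarrow>
    l2_inner M h (\<lambda>x. f x + g x) = l2_inner M h f + l2_inner M h g"
  using l2_inner_add_left[of f g h] by (simp add: L2_add conj_add l2_inner_commute[of _ h])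

lemma l2_inner_mult_right:
  "f \<in> L2 M \<Longrightarrow> h \<in> L2 M \<Longrightarrow> l2_inner M h (\<lambda>x. c * f x) = conj c * l2_inner M h f"
  using l2_inner_mult_left[of c f h] by (simp add: L2_mult conj_mult l2_inner_commute[of _ h])

lemma l2_inner_diff_left:
  "f \<in> L2 M \<Longrightarrow> g \<in> L2 M \<Longrightarrow> h \<in> L2 M \<Longrightarrow>
    l2_inner M (\<lambda>x. f x - g x) h = l2_inner M f h - l2_inner M g h"
  by (simp add: l2_inner_def left_diff_distrib integrable_L2_mult_conj)

lemma l2_inner_diff_right:
  "f \<in> L2 M \<Longrightarrow> g \<in> L2 M \<Longrightarrow> h \<in> L2 M \<Longrightarrow>
    l2_inner M h (\<lambda>x. f x - g x) = l2_inner M h f - l2_inner M h g"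
  using l2_inner_diff_left[of f g h]
  by (simp add: L2_diff linear_diff[OF bounded_linear.linear[OF bounded_linear_conj]]
      l2_inner_commute[of _ h])

lemma l2_inner_zero_left [simp]: "l2_inner M (\<lambda>_. 0) f = 0"
  and l2_inner_zero_right [simp]: "l2_inner M f (\<lambda>_. 0) = 0"
  by (simp_all add: l2_inner_def)

lemma l2_inner_cong_AE:
  assumes "f \<in> L2 M" "f' \<in> L2 M" "g \<in> L2 M" "g' \<in> L2 M"
    and "AE x in M. f x = f' x" "AE x in M. g x = g' x"
  shows "l2_inner M f g = l2_inner M f' g'"
proof -
  note [measurable] = assms(1-4)[THEN L2_D(1)]
  show ?thesis
    unfolding l2_inner_def by (rule integral_cong_AE) (use assms(5,6) in auto)
qed

section \<open>The norm and its relation to the inner product\<close>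

lemma l2_norm_nonneg [simp]: "0 \<le> l2_norm M f"
  by (simp add: l2_norm_def)

lemma l2_norm_power2: "(l2_norm M f)\<^sup>2 = (\<integral>x. (norm (f x))\<^sup>2 \<partial>M)"
  by (simp add: l2_norm_def)

lemma l2_norm_mult: "l2_norm M (\<lambda>x. c * f x) = norm c * l2_norm M f"
  by (simp add: l2_norm_def norm_mult power_mult_distrib real_sqrt_mult)

lemma l2_norm_minus_commute: "l2_norm M (\<lambda>x. f x - g x) = l2_norm M (\<lambda>x. g x - f x)"
  by (simp add: l2_norm_def norm_minus_commute)

lemma l2_norm_eq_0_iff: "l2_norm M f = 0 \<longleftrightarrow> (AE x in M. f x = 0)" if "f \<in> L2 M"
  using integral_nonneg_eq_0_iff_AE[OF L2_D(2)[OF that]] by (simp add: l2_norm_def)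

lemma l2_inner_same: "f \<in> L2 M \<Longrightarrow> l2_inner M f f = of_real ((l2_norm M f)\<^sup>2)"
  unfolding l2_inner_def mult_conj_of_real l2_norm_power2
  by (rule integral_of_real) (rule L2_D)

text \<open>The pointwise expansion is integrated; being bounded linear, \<open>inner _ 1\<close>
  commutes with the integral.\<close>

lemma l2_norm_add_power2:
  fixes f g :: "'a \<Rightarrow> 'k::real_or_complex"
  assumes f: "f \<in> L2 M" and g: "g \<in> L2 M"
  shows "(l2_norm M (\<lambda>x. f x + g x))\<^sup>2
    = (l2_norm M f)\<^sup>2 + (l2_norm M g)\<^sup>2 + 2 * inner (l2_inner M f g) 1"
proof -
  have "(norm (a + b))\<^sup>2 = (norm a)\<^sup>2 + (norm b)\<^sup>2 + 2 * inner (a * conj b) 1" for a b :: 'k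
    unfolding inner_eq_inner_one[symmetric]
    by (simp add: power2_norm_eq_inner inner_add_left inner_add_right inner_commute)
  then show ?thesis
    unfolding l2_norm_power2 l2_inner_def
    using L2_D(2)[OF f] L2_D(2)[OF g] integrable_L2_mult_conj[OF f g] by simp
qed

lemma l2_norm_diff_power2:
  fixes f g :: "'a \<Rightarrow> 'k::real_or_complex"
  assumes f: "f \<in> L2 M" and g: "g \<in> L2 M"
  shows "(l2_norm M (\<lambda>x. f x - g x))\<^sup>2
    = (l2_norm M f)\<^sup>2 + (l2_norm M g)\<^sup>2 - 2 * inner (l2_inner M f g) 1"
  using l2_norm_add_power2[OF f L2_mult[OF g, of "- 1"]]
    l2_norm_mult[of "- 1" g] l2_inner_mult_right[OF g f, of "- 1"]
  by simp

text \<open>The factor \<open>a\<close> adjusts the phase so that the cross term is real. The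
  parameter \<open>t\<close> stays free: the inverse of \<open>(l2_norm M g)\<^sup>2\<close> gives
  the projection onto the span of \<open>g\<close>, while a smaller value avoids dividing by
  zero.\<close>

lemma l2_norm_diff_projection:
  fixes f g :: "'a \<Rightarrow> 'k::real_or_complex"
  assumes f: "f \<in> L2 M" and g: "g \<in> L2 M"
  defines "a \<equiv> l2_inner M f g"
  shows "(l2_norm M (\<lambda>x. f x - of_real t * a * g x))\<^sup>2
    = (l2_norm M f)\<^sup>2 - 2 * t * (norm a)\<^sup>2 + t\<^sup>2 * (norm a)\<^sup>2 * (l2_norm M g)\<^sup>2"
proof -
  have "l2_inner M f (\<lambda>x. of_real t * a * g x) = of_real t * (a * conj a)"
    using l2_inner_mult_right[OF g f, of "of_real t * a"]
    by (simp add: conj_mult a_def mult_ac)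
  also have "\<dots> = of_real (t * (norm a)\<^sup>2)"
    by (simp add: mult_conj_of_real)
  finally have "inner (l2_inner M f (\<lambda>x. of_real t * a * g x)) 1 = t * (norm a)\<^sup>2"
    by (simp only: inner_of_real_one)
  then show ?thesis
    using l2_norm_diff_power2[OF f L2_mult[OF g, of "of_real t * a"]]
      l2_norm_mult[of "of_real t * a" g]
    by (simp add: norm_mult power_mult_distrib)
qed

text \<open>What remains of \<open>f\<close> after projection onto the span of \<open>g\<close> has
  nonnegative squared norm.\<close>

lemma l2_cauchy_schwarz:
  assumes f: "f \<in> L2 M" and g: "g \<in> L2 M"
  shows "norm (l2_inner M f g) \<le> l2_norm M f * l2_norm M g"
proof (cases "l2_norm M g = 0")
  case True
  then have "l2_inner M f g = l2_inner M f (\<lambda>_. 0)"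
    using l2_norm_eq_0_iff[OF g] by (intro l2_inner_cong_AE f g L2_zero) auto
  then show ?thesis
    by simp
next
  case False
  define G where "G = (l2_norm M g)\<^sup>2"
  have G: "G > 0"
    using False by (simp add: G_def)
  define A where "A = (norm (l2_inner M f g))\<^sup>2"
  \<comment> \<open>The quadratic in \<open>t\<close> is evaluated at its minimizer
    \<open>1 / G\<close>.\<close>
  have "0 \<le> (l2_norm M f)\<^sup>2 - 2 * (1 / G) * A + (1 / G)\<^sup>2 * A * G"
    unfolding A_def G_def using l2_norm_diff_projection[OF f g] by (metis zero_le_power2)
  also have "\<dots> = (l2_norm M f)\<^sup>2 - A / G"
    using G by (simp add: power2_eq_square)
  finally have "A \<le> (l2_norm M f * l2_norm M g)\<^sup>2"
    using G by (simp add: field_simps G_def)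
  then show ?thesis
    unfolding A_def by (rule power2_le_imp_le) simp
qed

lemma l2_norm_triangle:
  assumes f: "f \<in> L2 M" and g: "g \<in> L2 M"
  shows "l2_norm M (\<lambda>x. f x + g x) \<le> l2_norm M f + l2_norm M g"
proof (rule power2_le_imp_le)
  have "inner (l2_inner M f g) 1 \<le> l2_norm M f * l2_norm M g"
    using Cauchy_Schwarz_ineq2[of "l2_inner M f g" 1] l2_cauchy_schwarz[OF f g] by simp
  then show "(l2_norm M (\<lambda>x. f x + g x))\<^sup>2 \<le> (l2_norm M f + l2_norm M g)\<^sup>2"
    unfolding l2_norm_add_power2[OF f g] by (simp add: power2_sum)
qed simp

lemma l2_norm_diff_triangle:
  assumes "f \<in> L2 M" "g \<in> L2 M" "h \<in> L2 M"
  shows "l2_norm M (\<lambda>x. f x - h x) \<le> l2_norm M (\<lambda>x. f x - g x) + l2_norm M (\<lambda>x. g x - h x)"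
  using l2_norm_triangle[OF L2_diff[OF assms(1,2)] L2_diff[OF assms(2,3)]] by simp

section \<open>Completeness\<close>

lemma ennreal_l2_norm_power2:
  "f \<in> L2 M \<Longrightarrow> ennreal ((l2_norm M f)\<^sup>2) = (\<integral>\<^sup>+x. ennreal ((norm (f x))\<^sup>2) \<partial>M)"
  unfolding l2_norm_power2 by (rule nn_integral_eq_integral[symmetric]) (simp_all add: L2_D)

text \<open>Fatou's lemma in \<open>m\<close> carries the Cauchy bound on \<open>u m - u n\<close>
  over to \<open>f - u n\<close>. In particular \<open>f - u 0\<close> is square-integrable, and
  hence so is \<open>f\<close>.\<close>

lemma L2_limit_AE:
  fixes u :: "nat \<Rightarrow> 'a \<Rightarrow> 'k::real_or_complex"
  assumes u: "\<And>n. u n \<in> L2 M"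
    and f [measurable]: "f \<in> borel_measurable M"
    and lim: "AE x in M. (\<lambda>n. u n x) \<longlonglongrightarrow> f x"
    and bound: "\<And>n m. n \<le> m \<Longrightarrow> l2_norm M (\<lambda>x. u m x - u n x) \<le> e n"
    and e: "e \<longlonglongrightarrow> 0"
  shows "f \<in> L2 M" "(\<lambda>n. l2_norm M (\<lambda>x. f x - u n x)) \<longlonglongrightarrow> 0"
proof -
  note [measurable] = L2_D(1)[OF u]
  have e_nonneg: "0 \<le> e n" for n
    using bound[of n n] by (rule order_trans[OF l2_norm_nonneg]) simp
  have fatou: "(\<integral>\<^sup>+x. ennreal ((norm (f x - u n x))\<^sup>2) \<partial>M) \<le> ennreal ((e n)\<^sup>2)" for n
  proof -
    have "(\<integral>\<^sup>+x. ennreal ((norm (f x - u n x))\<^sup>2) \<partial>M)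
        = (\<integral>\<^sup>+x. liminf (\<lambda>m. ennreal ((norm (u m x - u n x))\<^sup>2)) \<partial>M)"
    proof (rule nn_integral_cong_AE, use lim in eventually_elim)
      case (elim x)
      then have "(\<lambda>m. ennreal ((norm (u m x - u n x))\<^sup>2)) \<longlonglongrightarrow> ennreal ((norm (f x - u n x))\<^sup>2)"
        by (intro tendsto_intros tendsto_ennrealI)
      then show ?case
        by (rule lim_imp_Liminf[symmetric, rotated]) simp
    qed
    also have "\<dots> \<le> liminf (\<lambda>m. \<integral>\<^sup>+x. ennreal ((norm (u m x - u n x))\<^sup>2) \<partial>M)"
      by (rule nn_integral_liminf) simp
    also have "\<dots> \<le> liminf (\<lambda>m. ennreal ((e n)\<^sup>2))"
    proof (rule Liminf_mono, rule eventually_sequentiallyI[of n])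
      fix m assume "n \<le> m"
      then show "(\<integral>\<^sup>+x. ennreal ((norm (u m x - u n x))\<^sup>2) \<partial>M) \<le> ennreal ((e n)\<^sup>2)"
        using bound[of n m]
        by (simp add: ennreal_l2_norm_power2[OF L2_diff[OF u u], symmetric] ennreal_leI power_mono)
    qed
    also have "\<dots> = ennreal ((e n)\<^sup>2)"
      by (simp add: Liminf_const)
    finally show ?thesis .
  qed
  have diff: "(\<lambda>x. f x - u n x) \<in> L2 M" for n
  proof -
    have "(\<integral>\<^sup>+x. ennreal ((norm (f x - u n x))\<^sup>2) \<partial>M) < \<infinity>"
      using fatou[of n] by (simp add: le_less_trans)
    then have "integrable M (\<lambda>x. (norm (f x - u n x))\<^sup>2)"
      by (intro integrableI_bounded) simp_all
    then show ?thesis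
      by (simp add: L2_def)
  qed
  show "f \<in> L2 M"
    using L2_add[OF diff[of 0] u[of 0]] by simp
  show "(\<lambda>n. l2_norm M (\<lambda>x. f x - u n x)) \<longlonglongrightarrow> 0"
  proof (rule tendsto_sandwich[OF _ _ tendsto_const e])
    have "l2_norm M (\<lambda>x. f x - u n x) \<le> e n" for n
    proof (rule power2_le_imp_le[OF _ e_nonneg])
      show "(l2_norm M (\<lambda>x. f x - u n x))\<^sup>2 \<le> (e n)\<^sup>2"
        using fatou[of n] by (simp add: ennreal_l2_norm_power2[OF diff, symmetric])
    qed
    then show "\<forall>\<^sub>F n in sequentially. l2_norm M (\<lambda>x. f x - u n x) \<le> e n"
      by simp
  qed simp
qed

text \<open>Rapid convergence makes \<open>\<Sum>n. 2 ^ n * \<bar>u (n + 1) - u n\<bar>\<^sup>2\<close> integrable, which forces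
  geometric decay of the increments almost everywhere.\<close>

lemma L2_complete:
  fixes u :: "nat \<Rightarrow> 'a \<Rightarrow> 'k::real_or_complex"
  assumes u: "\<And>n. u n \<in> L2 M"
    and bound: "\<And>n m. n \<le> m \<Longrightarrow> l2_norm M (\<lambda>x. u m x - u n x) \<le> B * (1 / 2) ^ n"
  obtains f where "f \<in> L2 M" "(\<lambda>n. l2_norm M (\<lambda>x. f x - u n x)) \<longlonglongrightarrow> 0"
proof -
  note [measurable] = L2_D(1)[OF u]
  define d where "d n x = u (Suc n) x - u n x" for n x
  have d: "d n \<in> L2 M" for n
    unfolding d_def by (rule L2_diff[OF u u])
  note [measurable] = L2_D(1)[OF d]
  \<comment> \<open>The squared increments decay like \<open>(1 / 4) ^ n\<close>, so the weight
    \<open>2 ^ n\<close> still leaves a convergent geometric series.\<close>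
  have term_le: "(\<integral>\<^sup>+x. ennreal (2 ^ n * (norm (d n x))\<^sup>2) \<partial>M) \<le> ennreal (B\<^sup>2 * (1 / 2) ^ n)" for n
  proof -
    have "(l2_norm M (d n))\<^sup>2 \<le> (B * (1 / 2) ^ n)\<^sup>2"
      using bound[of n "Suc n"] by (intro power_mono) (simp_all add: d_def[abs_def])
    then have "2 ^ n * (l2_norm M (d n))\<^sup>2 \<le> 2 ^ n * (B * (1 / 2) ^ n)\<^sup>2"
      by simp
    also have "\<dots> = B\<^sup>2 * (1 / 2) ^ n"
      by (simp add: power_mult_distrib power_divide power2_eq_square)
    finally have "ennreal (2 ^ n) * ennreal ((l2_norm M (d n))\<^sup>2) \<le> ennreal (B\<^sup>2 * (1 / 2) ^ n)"
      by (subst ennreal_mult[symmetric]) (simp_all add: ennreal_leI)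
    then show ?thesis
      unfolding ennreal_l2_norm_power2[OF d]
      by (subst ennreal_mult) (simp_all add: nn_integral_cmult)
  qed
  have "(\<integral>\<^sup>+x. (\<Sum>n. ennreal (2 ^ n * (norm (d n x))\<^sup>2)) \<partial>M)
      = (\<Sum>n. \<integral>\<^sup>+x. ennreal (2 ^ n * (norm (d n x))\<^sup>2) \<partial>M)"
    by (rule nn_integral_suminf) simp
  also have "\<dots> \<le> (\<Sum>n. ennreal (B\<^sup>2 * (1 / 2) ^ n))"
    by (rule suminf_le[OF term_le]) auto
  also have "\<dots> < \<infinity>"
  proof -
    have "summable (\<lambda>n. B\<^sup>2 * (1 / 2 :: real) ^ n)"
      by (intro summable_mult summable_geometric) simp
    then show ?thesis
      by (subst suminf_ennreal2) simp_all
  qed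
  finally have "AE x in M. (\<Sum>n. ennreal (2 ^ n * (norm (d n x))\<^sup>2)) \<noteq> \<infinity>"
    by (intro nn_integral_PInf_AE) simp_all
  then have conv: "AE x in M. convergent (\<lambda>n. u n x)"
  proof eventually_elim
    case (elim x)
    define t where "t n = ennreal (2 ^ n * (norm (d n x))\<^sup>2)" for n
    define S where "S = enn2real (suminf t)"
    have S: "S \<ge> 0" "suminf t = ennreal S"
      using elim unfolding S_def t_def by (simp_all add: less_top)
    \<comment> \<open>A single term is at most the whole sum \<open>S\<close>; undoing the weight
      leaves geometric decay with ratio \<open>sqrt (1 / 2)\<close>, which is below 1.\<close>
    have "norm (d n x) \<le> sqrt S * sqrt (1 / 2) ^ n" for n
    proof (rule power2_le_imp_le)
      have "sum t {n} \<le> suminf t"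
        by (rule sum_le_suminf) auto
      then have "2 ^ n * (norm (d n x))\<^sup>2 \<le> S"
        using S by (simp add: t_def)
      then have "(norm (d n x))\<^sup>2 \<le> S * (1 / 2) ^ n"
        by (simp add: field_simps)
      also have "\<dots> = (sqrt S)\<^sup>2 * (sqrt (1 / 2) ^ n)\<^sup>2"
        using S(1) by (simp only: power_mult[symmetric] mult.commute[of n] real_sqrt_pow2)
          (simp add: power_mult)
      finally show "(norm (d n x))\<^sup>2 \<le> (sqrt S * sqrt (1 / 2) ^ n)\<^sup>2"
        by (simp only: power_mult_distrib)
    qed (use S(1) in simp)
    moreover have "summable (\<lambda>n. sqrt S * sqrt (1 / 2) ^ n)"
      by (intro summable_mult summable_geometric) (simp add: real_sqrt_divide)
    ultimately have "summable (\<lambda>n. d n x)"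
      by (intro summable_comparison_test[where f = "\<lambda>n. d n x" and g = "\<lambda>n. sqrt S * sqrt (1 / 2) ^ n"])
        auto
    then have "convergent (\<lambda>n. \<Sum>i<n. d i x)"
      by (simp add: summable_iff_convergent)
    then have "convergent (\<lambda>n. u 0 x + (u n x - u 0 x))"
      by (intro convergent_add convergent_const)
        (simp add: d_def sum_lessThan_telescope[of "\<lambda>n. u n x"])
    then show ?case
      by simp
  qed
  have e: "(\<lambda>n. B * (1 / 2) ^ n) \<longlonglongrightarrow> 0"
    by (intro tendsto_mult_right_zero LIMSEQ_realpow_zero) simp_all
  \<comment> \<open>The value of \<open>lim\<close> is unspecified where the sequence diverges, but
    this happens on a null set only.\<close>
  define f where "f x = lim (\<lambda>n. u n x)" for x
  have f: "f \<in> borel_measurable M"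
    unfolding f_def by measurable
  have "AE x in M. (\<lambda>n. u n x) \<longlonglongrightarrow> f x"
    using conv by eventually_elim (simp add: f_def convergent_LIMSEQ_iff)
  from L2_limit_AE[OF u f this bound e] show ?thesis
    by (rule that)
qed

text \<open>By Cauchy-Schwarz, convergence in norm controls the inner product with a fixed
  vector.\<close>

lemma l2_inner_limit:
  assumes u: "\<And>n. u n \<in> L2 M" and f: "f \<in> L2 M" and g: "g \<in> L2 M"
    and lim: "(\<lambda>n. l2_norm M (\<lambda>x. f x - u n x)) \<longlonglongrightarrow> 0"
  shows "(\<lambda>n. l2_inner M (u n) g) \<longlonglongrightarrow> l2_inner M f g"
proof (rule Lim_transform2[OF tendsto_const])
  show "(\<lambda>n. l2_inner M f g - l2_inner M (u n) g) \<longlonglongrightarrow> 0"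
  proof (rule Lim_null_comparison)
    show "(\<lambda>n. l2_norm M (\<lambda>x. f x - u n x) * l2_norm M g) \<longlonglongrightarrow> 0"
      by (rule tendsto_mult_left_zero[OF lim])
    show "\<forall>\<^sub>F n in sequentially. norm (l2_inner M f g - l2_inner M (u n) g)
        \<le> l2_norm M (\<lambda>x. f x - u n x) * l2_norm M g"
      using l2_cauchy_schwarz[OF L2_diff[OF f u] g] by (simp add: l2_inner_diff_left f g u)
  qed
qed

section \<open>Adjoints\<close>

lemma l2_adjoint_antimono: "A \<subseteq> B \<Longrightarrow> l2_adjoint M B \<subseteq> l2_adjoint M A"
  by (fastforce simp: l2_adjoint_def)

lemma l2_adjoint_subset: "l2_adjoint M A \<subseteq> L2 M \<times> L2 M"
  by (auto simp: l2_adjoint_def)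

text \<open>The relation defining the adjoint is symmetric in the two pairs up to
  conjugation.\<close>

lemma l2_adjoint_adjoint_superset:
  assumes "A \<subseteq> L2 M \<times> L2 M"
  shows "A \<subseteq> l2_adjoint M (l2_adjoint M A)"
proof clarify
  fix f Tf assume fTf: "(f, Tf) \<in> A"
  then have L2: "f \<in> L2 M" "Tf \<in> L2 M"
    using assms by auto
  have "l2_inner M h f = l2_inner M g Tf" if "(g, h) \<in> l2_adjoint M A" for g h
  proof -
    have "g \<in> L2 M" "h \<in> L2 M" "l2_inner M Tf g = l2_inner M f h"
      using that fTf by (auto simp: l2_adjoint_def)
    then show ?thesis
      using L2 by (simp add: l2_inner_commute[of f] l2_inner_commute[of Tf])
  qed
  then show "(f, Tf) \<in> l2_adjoint M (l2_adjoint M A)"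
    using L2 by (auto simp: l2_adjoint_def)
qed

text \<open>As in any Galois connection, antitonicity applied to the inclusion of \<open>A\<close>
  in its double adjoint gives one direction, and the inclusion of \<open>l2_adjoint M A\<close> in
  its own double adjoint gives the other.\<close>

lemma l2_adjoint_triple:
  assumes "A \<subseteq> L2 M \<times> L2 M"
  shows "l2_adjoint M (l2_adjoint M (l2_adjoint M A)) = l2_adjoint M A"
  using l2_adjoint_antimono[OF l2_adjoint_adjoint_superset[OF assms]]
    l2_adjoint_adjoint_superset[OF l2_adjoint_subset] by (rule antisym)

section \<open>Adjoints as linear graphs invariant under almost everywhere equality\<close>

lemma l2_adjoint_cong_AE:
  assumes A: "A \<subseteq> L2 M \<times> L2 M" and "(f, g) \<in> l2_adjoint M A"
    and "f' \<in> L2 M" "g' \<in> L2 M" "AE x in M. f' x = f x" "AE x in M. g' x = g x"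
  shows "(f', g') \<in> l2_adjoint M A"
proof -
  have L2: "f \<in> L2 M" "g \<in> L2 M"
    using assms(2) by (auto simp: l2_adjoint_def)
  have "l2_inner M v f' = l2_inner M u g'" if "(u, v) \<in> A" for u v
  proof -
    have "u \<in> L2 M" "v \<in> L2 M" "l2_inner M v f = l2_inner M u g"
      using that A assms(2) by (auto simp: l2_adjoint_def)
    then show ?thesis
      using l2_inner_cong_AE[of v v f' f] l2_inner_cong_AE[of u u g' g] L2 assms(3-) by simp
  qed
  then show ?thesis
    using assms(3,4) by (auto simp: l2_adjoint_def)
qed

lemma l2_adjoint_zero: "(\<lambda>_. 0, \<lambda>_. 0) \<in> l2_adjoint M A"
  by (auto simp: l2_adjoint_def L2_zero)

lemma l2_adjoint_add:
  assumes "A \<subseteq> L2 M \<times> L2 M" "(f, g) \<in> l2_adjoint M A" "(f', g') \<in> l2_adjoint M A"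
  shows "(\<lambda>x. f x + f' x, \<lambda>x. g x + g' x) \<in> l2_adjoint M A"
  using assms by (fastforce simp: l2_adjoint_def L2_add l2_inner_add_right)

lemma l2_adjoint_diff:
  assumes "A \<subseteq> L2 M \<times> L2 M" "(f, g) \<in> l2_adjoint M A" "(f', g') \<in> l2_adjoint M A"
  shows "(\<lambda>x. f x - f' x, \<lambda>x. g x - g' x) \<in> l2_adjoint M A"
  using assms by (fastforce simp: l2_adjoint_def L2_diff l2_inner_diff_right)

lemma l2_adjoint_mult:
  assumes "A \<subseteq> L2 M \<times> L2 M" "(f, g) \<in> l2_adjoint M A"
  shows "(\<lambda>x. c * f x, \<lambda>x. c * g x) \<in> l2_adjoint M A"
  using assms by (fastforce simp: l2_adjoint_def L2_mult l2_inner_mult_right)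

text \<open>The closure is a double adjoint; its defining identities survive norm limits of pairs
  because the inner product is continuous.\<close>

lemma l2_closure_limit:
  assumes A: "A \<subseteq> L2 M \<times> L2 M" and uv: "\<And>n. (u n, v n) \<in> A"
    and f: "f \<in> L2 M" and g: "g \<in> L2 M"
    and "(\<lambda>n. l2_norm M (\<lambda>x. f x - u n x)) \<longlonglongrightarrow> 0"
    and "(\<lambda>n. l2_norm M (\<lambda>x. g x - v n x)) \<longlonglongrightarrow> 0"
  shows "(f, g) \<in> l2_closure M A"
proof -
  have u: "u n \<in> L2 M" and v: "v n \<in> L2 M" for n
    using A uv[of n] by auto
  have "l2_inner M q f = l2_inner M p g" if pq: "(p, q) \<in> l2_adjoint M A" for p q
  proof -
    have p: "p \<in> L2 M" and q: "q \<in> L2 M"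
      and "\<And>n. l2_inner M (v n) p = l2_inner M (u n) q"
      using pq uv by (auto simp: l2_adjoint_def)
    then have "l2_inner M g p = l2_inner M f q"
      using l2_inner_limit[OF u f q assms(5)] l2_inner_limit[OF v g p assms(6)]
      by (simp add: LIMSEQ_unique)
    then show ?thesis
      using f g p q by (simp add: l2_inner_commute[of f] l2_inner_commute[of g])
  qed
  then show ?thesis
    using f g by (auto simp: l2_closure_def l2_adjoint_def)
qed

section \<open>Orthogonality and projection onto a closed range\<close>

text \<open>If \<open>g\<close> were nonzero, some \<open>h\<close> in \<open>V\<close> would
  satisfy ||g - h|| < ||g||, and then ||g||^2 = <g - h, g> \<le> ||g - h|| ||g|| < ||g||^2.\<close>

lemma dense_orthogonal_AE_zero:
  assumes dense: "\<And>f e. f \<in> L2 M \<Longrightarrow> e > 0 \<Longrightarrow> \<exists>h\<in>V. l2_norm M (\<lambda>x. f x - h x) < e"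
    and V: "V \<subseteq> L2 M" and g: "g \<in> L2 M" and ortho: "\<And>h. h \<in> V \<Longrightarrow> l2_inner M h g = 0"
  shows "AE x in M. g x = 0"
proof (rule ccontr)
  assume "\<not> ?thesis"
  then have pos: "l2_norm M g > 0"
    using l2_norm_eq_0_iff[OF g] l2_norm_nonneg[of g] by linarith
  then obtain h where h: "h \<in> V" "l2_norm M (\<lambda>x. g x - h x) < l2_norm M g"
    using dense[OF g] by blast
  have "(l2_norm M g)\<^sup>2 = norm (l2_inner M (\<lambda>x. g x - h x) g)"
    using h V g by (subst l2_inner_diff_left) (auto simp: ortho l2_inner_same norm_power)
  also have "\<dots> \<le> l2_norm M (\<lambda>x. g x - h x) * l2_norm M g"
    using h V g by (intro l2_cauchy_schwarz L2_diff) auto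
  also have "\<dots> < (l2_norm M g)\<^sup>2"
    using h(2) pos by (simp add: power2_eq_square)
  finally show False
    by simp
qed

text \<open>If \<open>w\<close> had a component along \<open>v\<close>, subtracting a small multiple
  of \<open>v\<close> would shorten it.\<close>

lemma minimal_norm_orthogonal:
  fixes w v :: "'a \<Rightarrow> 'k::real_or_complex"
  assumes w: "w \<in> L2 M" and v: "v \<in> L2 M"
    and min: "\<And>c. l2_norm M w \<le> l2_norm M (\<lambda>x. w x - c * v x)"
  shows "l2_inner M v w = 0"
proof -
  define A where "A = (norm (l2_inner M w v))\<^sup>2"
  \<comment> \<open>Adding 1 keeps \<open>G\<close> positive even for \<open>v\<close> of norm zero,
    and the choice \<open>1 / G\<close> for \<open>t\<close> still decreases the norm unless
    \<open>A\<close> is zero.\<close>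
  define G where "G = (l2_norm M v)\<^sup>2 + 1"
  have G: "G > 0"
    by (simp add: G_def add_nonneg_pos)
  have "(l2_norm M w)\<^sup>2 \<le> (l2_norm M w)\<^sup>2 - 2 * (1 / G) * A + (1 / G)\<^sup>2 * A * (l2_norm M v)\<^sup>2"
    unfolding A_def l2_norm_diff_projection[OF w v, of "1 / G", symmetric]
    by (intro power_mono min) simp
  also have "\<dots> \<le> (l2_norm M w)\<^sup>2 - 2 * (1 / G) * A + (1 / G)\<^sup>2 * A * G"
    by (simp add: G_def A_def mult_left_mono)
  also have "\<dots> = (l2_norm M w)\<^sup>2 - A / G"
    using G by (simp add: power2_eq_square)
  finally have "A \<le> 0"
    using G by (simp add: field_simps)
  then show ?thesis
    using l2_inner_commute[OF w v] by (simp add: A_def)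
qed

text \<open>A bounded-below operator pulls a minimizing sequence in its range back to a Cauchy sequence in
  its domain, so the projection of \<open>h\<close> onto the closed range is attained by the closure.\<close>

lemma closure_range_projection:
  fixes T :: "('a, 'k::real_or_complex) l2_graph"
  assumes T: "l2_operator M T" and C: "C > 0"
    and below: "\<And>f g. (f, g) \<in> T \<Longrightarrow> C * l2_norm M f \<le> l2_norm M g"
    and h: "h \<in> L2 M"
  obtains f k where "(f, k) \<in> l2_closure M T" "(\<lambda>x. h x - k x, \<lambda>_. 0) \<in> l2_adjoint M T"
proof -
  have T_sub: "T \<subseteq> L2 M \<times> L2 M"
    using T by (simp add: l2_operator_def)
  have T_zero: "(\<lambda>_. 0, \<lambda>_. 0) \<in> T"
    using T by (simp add: l2_operator_def)
  have "\<forall>(f, g) \<in> T. \<forall>(f', g') \<in> T. (\<lambda>x. f x + f' x, \<lambda>x. g x + g' x) \<in> T"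
    using T unfolding l2_operator_def by (elim conjE)
  moreover have "\<forall>c. \<forall>(f, g) \<in> T. (\<lambda>x. c * f x, \<lambda>x. c * g x) \<in> T"
    using T unfolding l2_operator_def by (elim conjE)
  ultimately have T_add: "(f, g) \<in> T \<Longrightarrow> (f', g') \<in> T \<Longrightarrow> (\<lambda>x. f x + f' x, \<lambda>x. g x + g' x) \<in> T"
    and T_mult: "(f, g) \<in> T \<Longrightarrow> (\<lambda>x. c * f x, \<lambda>x. c * g x) \<in> T" for f g f' g' c
    by fast+
  have T_diff: "(\<lambda>x. f x - f' x, \<lambda>x. g x - g' x) \<in> T" if "(f, g) \<in> T" "(f', g') \<in> T" for f g f' g'
    using T_add[OF that(1) T_mult[OF that(2), of "- 1"]] by simp
  \<comment> \<open>The number \<open>d\<close> is the distance from \<open>h\<close> to the range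
    of \<open>T\<close>; the infimum is taken over squared distances to suit the parallelogram
    law.\<close>
  define N where "N v = l2_norm M (\<lambda>x. h x - v x)" for v
  define D where "D = (\<lambda>v. (N v)\<^sup>2) ` Range T"
  define d where "d = sqrt (Inf D)"
  have D_ne: "D \<noteq> {}" and D_bdd: "bdd_below D"
    using T_zero by (auto simp: D_def intro!: bdd_belowI[of _ 0])
  have D_nonneg: "Inf D \<ge> 0"
    using D_ne by (intro cInf_greatest) (auto simp: D_def)
  have d_le_N2: "Inf D \<le> (N v)\<^sup>2" if "(u, v) \<in> T" for u v
    using that by (intro cInf_lower D_bdd) (auto simp: D_def)
  have d_le: "d \<le> N v" if "(u, v) \<in> T" for u v
    using d_le_N2[OF that] by (auto simp: d_def N_def intro: real_le_lsqrt)
  \<comment> \<open>The tolerance \<open>(1 / 4) ^ n\<close> on squares becomes the rate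
    \<open>(1 / 2) ^ n\<close> on norms that \<open>L2_complete\<close> asks for.\<close>
  have "\<exists>u v. (u, v) \<in> T \<and> (N v)\<^sup>2 < Inf D + (1 / 4) ^ n" for n
    using cInf_lessD[OF D_ne, of "Inf D + (1 / 4) ^ n"] by (auto simp: D_def)
  then obtain u v where uv: "\<And>n. (u n, v n) \<in> T" "\<And>n. (N (v n))\<^sup>2 < Inf D + (1 / 4) ^ n"
    by metis
  have u: "u n \<in> L2 M" and v: "v n \<in> L2 M" for n
    using T_sub uv(1)[of n] by auto
  have v_cauchy: "l2_norm M (\<lambda>x. v m x - v n x) \<le> 2 * (1 / 2) ^ n" if "n \<le> m" for n m
  proof (rule power2_le_imp_le)
    define a where "a x = h x - v n x" for x
    define b where "b x = h x - v m x" for x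
    have ab: "a \<in> L2 M" "b \<in> L2 M"
      unfolding a_def b_def by (intro L2_diff h v)+
    \<comment> \<open>The midpoint of \<open>v n\<close> and \<open>v m\<close> lies in the range,
      so the parallelogram law turns near-optimality of both into closeness.\<close>
    have "(\<lambda>x. (1 / 2) * (u n x + u m x), \<lambda>x. (1 / 2) * (v n x + v m x)) \<in> T"
      by (intro T_mult T_add uv)
    from d_le_N2[OF this] have "Inf D \<le> (l2_norm M (\<lambda>x. (1 / 2) * (a x + b x)))\<^sup>2"
      by (simp add: N_def a_def b_def field_simps)
    also have "\<dots> = (1 / 4) * (l2_norm M (\<lambda>x. a x + b x))\<^sup>2"
      unfolding l2_norm_mult by (simp add: norm_divide power_mult_distrib power2_eq_square)
    finally have "4 * Inf D \<le> (l2_norm M (\<lambda>x. a x + b x))\<^sup>2"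
      by simp
    moreover have "(l2_norm M (\<lambda>x. a x - b x))\<^sup>2
        = 2 * (l2_norm M a)\<^sup>2 + 2 * (l2_norm M b)\<^sup>2 - (l2_norm M (\<lambda>x. a x + b x))\<^sup>2"
      using l2_norm_add_power2[OF ab] l2_norm_diff_power2[OF ab] by simp
    moreover have "(l2_norm M a)\<^sup>2 \<le> Inf D + (1 / 4) ^ n"
      using uv(2)[of n] by (simp add: N_def a_def[abs_def])
    moreover have "(l2_norm M b)\<^sup>2 \<le> Inf D + (1 / 4) ^ m"
      using uv(2)[of m] by (simp add: N_def b_def[abs_def])
    moreover have "(1 / 4 :: real) ^ m \<le> (1 / 4) ^ n"
      using that by (intro power_decreasing) simp_all
    ultimately have "(l2_norm M (\<lambda>x. a x - b x))\<^sup>2 \<le> 4 * (1 / 4) ^ n"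
      by linarith
    also have "((1 / 4) ^ n :: real) = ((1 / 2) ^ n)\<^sup>2"
      by (simp add: power2_eq_square flip: power_mult_distrib)
    also have "4 * ((1 / 2) ^ n)\<^sup>2 = (2 * (1 / 2) ^ n :: real)\<^sup>2"
      by (simp only: power_mult_distrib) simp
    finally show "(l2_norm M (\<lambda>x. v m x - v n x))\<^sup>2 \<le> (2 * (1 / 2) ^ n)\<^sup>2"
      by (simp add: a_def b_def)
  qed simp
  then obtain k where k: "k \<in> L2 M" "(\<lambda>n. l2_norm M (\<lambda>x. k x - v n x)) \<longlonglongrightarrow> 0"
    by (rule L2_complete[OF v])
  \<comment> \<open>The lower bound \<open>below\<close> transfers the Cauchy rate from the images
    to the preimages.\<close>
  have "l2_norm M (\<lambda>x. u m x - u n x) \<le> 2 / C * (1 / 2) ^ n" if "n \<le> m" for n m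
    using order_trans[OF below[OF T_diff[OF uv(1) uv(1)]] v_cauchy[OF that]] C
    by (simp add: field_simps)
  then obtain f where f: "f \<in> L2 M" "(\<lambda>n. l2_norm M (\<lambda>x. f x - u n x)) \<longlonglongrightarrow> 0"
    by (rule L2_complete[OF u])
  \<comment> \<open>The triangle inequality through \<open>v n\<close> passes to the limit.\<close>
  have "N k \<le> d"
  proof (rule LIMSEQ_le_const)
    show "(\<lambda>n. sqrt (Inf D + (1 / 4) ^ n) + l2_norm M (\<lambda>x. k x - v n x)) \<longlonglongrightarrow> d"
      unfolding d_def
      by (rule tendsto_eq_intros tendsto_real_sqrt LIMSEQ_realpow_zero k(2) | simp)+
    have "N k \<le> sqrt (Inf D + (1 / 4) ^ n) + l2_norm M (\<lambda>x. k x - v n x)" for n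
    proof -
      have "N (v n) \<le> sqrt (Inf D + (1 / 4) ^ n)"
        using uv(2)[of n] by (intro real_le_rsqrt) simp
      then show ?thesis
        using l2_norm_diff_triangle[OF h v[of n] k(1)] l2_norm_minus_commute[of k "v n"]
        by (simp add: N_def)
    qed
    then show "\<exists>N'. \<forall>n\<ge>N'. N k \<le> sqrt (Inf D + (1 / 4) ^ n) + l2_norm M (\<lambda>x. k x - v n x)"
      by blast
  qed
  \<comment> \<open>The limit \<open>k\<close> need not lie in the range itself, but
    \<open>v n + c * q\<close> does, and \<open>h - k - c * q\<close> is the limit of
    \<open>h - (v n + c * q)\<close>.\<close>
  have "d \<le> l2_norm M (\<lambda>x. h x - k x - c * q x)" if pq: "(p, q) \<in> T" for p q c
  proof (rule LIMSEQ_le_const)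
    show "(\<lambda>n. l2_norm M (\<lambda>x. h x - k x - c * q x) + l2_norm M (\<lambda>x. k x - v n x))
        \<longlonglongrightarrow> l2_norm M (\<lambda>x. h x - k x - c * q x)"
      by (rule tendsto_eq_intros k(2) | simp)+
    have q: "q \<in> L2 M"
      using T_sub pq by auto
    have "d \<le> l2_norm M (\<lambda>x. h x - k x - c * q x) + l2_norm M (\<lambda>x. k x - v n x)" for n
    proof -
      have "d \<le> N (\<lambda>x. v n x + c * q x)"
        by (rule d_le[OF T_add[OF uv(1) T_mult[OF pq]]])
      also have "\<dots> = l2_norm M (\<lambda>x. (h x - k x - c * q x) + (k x - v n x))"
        by (simp add: N_def algebra_simps)
      also have "\<dots> \<le> l2_norm M (\<lambda>x. h x - k x - c * q x) + l2_norm M (\<lambda>x. k x - v n x)"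
        by (intro l2_norm_triangle L2_diff L2_mult h k v q)
      finally show ?thesis .
    qed
    then show "\<exists>N'. \<forall>n\<ge>N'. d \<le> l2_norm M (\<lambda>x. h x - k x - c * q x)
        + l2_norm M (\<lambda>x. k x - v n x)"
      by blast
  qed
  \<comment> \<open>Thus \<open>h - k\<close> cannot be shortened by subtracting multiples of
    \<open>q\<close>, for any \<open>q\<close> in the range, and is orthogonal to the range.\<close>
  with \<open>N k \<le> d\<close> have "l2_inner M q (\<lambda>x. h x - k x) = 0" if "(p, q) \<in> T" for p q
    using that T_sub
    by (intro minimal_norm_orthogonal L2_diff h k(1)) (auto simp: N_def intro: order_trans)
  then have "(\<lambda>x. h x - k x, \<lambda>_. 0) \<in> l2_adjoint M T"
    using h k(1) by (auto simp: l2_adjoint_def L2_diff L2_zero)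
  moreover have "(f, k) \<in> l2_closure M T"
    by (rule l2_closure_limit[OF T_sub uv(1) f(1) k(1) f(2) k(2)])
  ultimately show ?thesis
    using that by blast
qed

section \<open>Symmetric operators\<close>

lemma symmetric_subset_adjoint:
  assumes "symmetric_operator M T"
  shows "T \<subseteq> l2_adjoint M T"
proof -
  have "T \<subseteq> L2 M \<times> L2 M"
    and "\<forall>(f, Tf) \<in> T. \<forall>(g, Tg) \<in> T. l2_inner M Tf g = l2_inner M f Tg"
    using assms by (simp_all add: symmetric_operator_def l2_operator_def)
  then show ?thesis
    by (fastforce simp: l2_adjoint_def)
qed

lemma symmetric_closure_subset_adjoint:
  assumes "symmetric_operator M T"
  shows "l2_closure M T \<subseteq> l2_adjoint M T"
  unfolding l2_closure_def by (rule l2_adjoint_antimono[OF symmetric_subset_adjoint[OF assms]])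

lemma symmetric_subset_L2: "symmetric_operator M T \<Longrightarrow> T \<subseteq> L2 M \<times> L2 M"
  by (simp add: symmetric_operator_def l2_operator_def)

section \<open>The closure as an operator and essential self-adjointness\<close>

text \<open>Two values differ by a function orthogonal to the dense domain.\<close>

lemma adjoint_single_valued:
  assumes T: "T \<subseteq> L2 M \<times> L2 M" and dense: "densely_defined M T"
    and "(f, g) \<in> l2_adjoint M T" "(f, g') \<in> l2_adjoint M T"
  shows "AE x in M. g x = g' x"
proof -
  have zero: "(\<lambda>x. f x - f x, \<lambda>x. g x - g' x) \<in> l2_adjoint M T"
    by (rule l2_adjoint_diff[OF T assms(3,4)])
  have "AE x in M. g x - g' x = 0"
  proof (rule dense_orthogonal_AE_zero[of "Domain T"])
    show "l2_inner M h (\<lambda>x. g x - g' x) = 0" if "h \<in> Domain T" for h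
      using zero that by (fastforce simp: l2_adjoint_def)
  qed (use dense T zero in \<open>auto simp: densely_defined_def l2_adjoint_def\<close>)
  then show ?thesis
    by simp
qed

text \<open>The linear structure is that of any adjoint; single-valuedness is inherited from
  \<open>T*\<close>, which contains the closure by symmetry.\<close>

lemma l2_operator_closure:
  assumes T: "symmetric_operator M T"
  shows "l2_operator M (l2_closure M T)"
proof -
  note sub = symmetric_closure_subset_adjoint[OF T]
  note L2 = l2_adjoint_subset[of T]
  have "AE x in M. g x = g' x" if "(f, g) \<in> l2_closure M T" "(f, g') \<in> l2_closure M T" for f g g'
    using adjoint_single_valued[OF symmetric_subset_L2[OF T]] T that sub
    unfolding symmetric_operator_def by blast
  then show ?thesis
    unfolding l2_operator_def l2_closure_def
    using l2_adjoint_subset[of "l2_adjoint M T"]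
    by (intro conjI) (auto intro: l2_adjoint_cong_AE[OF L2] l2_adjoint_zero l2_adjoint_add[OF L2]
      l2_adjoint_mult[OF L2])
qed

text \<open>The closure \<open>T**\<close> is densely defined because it contains \<open>T\<close>,
  and its adjoint \<open>T***\<close> equals \<open>T*\<close>; so self-adjointness of the closure
  reduces to one equation.\<close>

lemma essentially_self_adjoint_iff:
  assumes T: "symmetric_operator M T"
  shows "essentially_self_adjoint M T \<longleftrightarrow> l2_closure M T = l2_adjoint M T"
proof -
  note TL2 = symmetric_subset_L2[OF T]
  have "densely_defined M (l2_closure M T)"
    using l2_adjoint_adjoint_superset[OF TL2] T
    unfolding symmetric_operator_def densely_defined_def l2_closure_def
    by (meson Domain_mono subsetD)
  then show ?thesis
    using l2_operator_closure[OF T] l2_adjoint_triple[OF TL2]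
    by (auto simp: essentially_self_adjoint_def self_adjoint_def l2_closure_def)
qed

text \<open>By Cauchy-Schwarz, C ||f||^2 \<le> <Tf, f> \<le> ||Tf|| ||f||, and one factor ||f||
  cancels.\<close>

lemma strictly_positive_bounded_below:
  assumes T: "T \<subseteq> L2 M \<times> L2 M" and "strictly_positive M T"
  obtains C where "C > 0" "\<And>f g. (f, g) \<in> T \<Longrightarrow> C * l2_norm M f \<le> l2_norm M g"
proof -
  obtain C where C: "C > 0"
    and pos: "\<And>f g. (f, g) \<in> T \<Longrightarrow> \<exists>r. l2_inner M g f = of_real r \<and> r \<ge> C * (l2_norm M f)\<^sup>2"
    using assms(2) by (fastforce simp: strictly_positive_def)
  have "C * l2_norm M f \<le> l2_norm M g" if fg: "(f, g) \<in> T" for f g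
  proof (cases "l2_norm M f = 0")
    case False
    obtain r where r: "l2_inner M g f = of_real r" "r \<ge> C * (l2_norm M f)\<^sup>2"
      using pos[OF fg] by blast
    have "C * l2_norm M f * l2_norm M f \<le> norm (l2_inner M g f)"
      using r by (simp add: power2_eq_square)
    also have "\<dots> \<le> l2_norm M g * l2_norm M f"
      using T fg by (intro l2_cauchy_schwarz) auto
    finally show ?thesis
      using False l2_norm_nonneg[of f] by (simp add: mult_le_cancel_right)
  qed simp
  with C show ?thesis
    by (rule that)
qed

text \<open>If \<open>c\<close> is the constant, then |c|^2 m(X) = ||f||^2 is finite, which forces
  \<open>c\<close> to vanish.\<close>

lemma ae_constant_L2_AE_zero:
  fixes f :: "'a \<Rightarrow> 'k::real_or_complex"
  assumes f: "f \<in> L2 M" and const: "ae_constant M f" and inf: "emeasure M (space M) = \<infinity>"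
  shows "AE x in M. f x = 0"
proof -
  obtain c where c: "AE x in M. f x = c"
    using const by (auto simp: ae_constant_def)
  have "ennreal ((norm c)\<^sup>2) * emeasure M (space M) = (\<integral>\<^sup>+x. ennreal ((norm c)\<^sup>2) \<partial>M)"
    by simp
  also have "\<dots> = (\<integral>\<^sup>+x. ennreal ((norm (f x))\<^sup>2) \<partial>M)"
    using c by (intro nn_integral_cong_AE) auto
  also have "\<dots> = ennreal ((l2_norm M f)\<^sup>2)"
    by (rule ennreal_l2_norm_power2[OF f, symmetric])
  finally have "c = 0"
    using inf by (cases "c = 0") (simp_all add: ennreal_mult_top)
  with c show ?thesis
    by simp
qed

end

section \<open>From essential self-adjointness to the Liouville property and back\<close>

theorem theorem1:
  fixes M :: "'a measure"
    and T :: "('a, 'k::real_or_complex) l2_graph"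
  assumes "symmetric_operator M T"
    and "\<forall>f \<in> l2_kernel (l2_closure M T). ae_constant M f"
  shows "(essentially_self_adjoint M T \<longrightarrow> l2_liouville M T) \<and>
         (l2_liouville M T \<and> strictly_positive M T \<and> emeasure M (space M) = \<infinity> \<longrightarrow>
            essentially_self_adjoint M T)"
proof (intro conjI impI)
  assume "essentially_self_adjoint M T"
  \<comment> \<open>The closure and the adjoint coincide, so the hypothesis on the kernel of the
    closure applies to the kernel of the adjoint.\<close>
  then show "l2_liouville M T"
    using assms(2) by (simp add: essentially_self_adjoint_iff[OF assms(1)] l2_liouville_def)
next
  assume *: "l2_liouville M T \<and> strictly_positive M T \<and> emeasure M (space M) = \<infinity>"
  note TL2 = symmetric_subset_L2[OF assms(1)]
  note closure_sub = symmetric_closure_subset_adjoint[OF assms(1)]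
  obtain C where C: "C > 0" "\<And>f g. (f, g) \<in> T \<Longrightarrow> C * l2_norm M f \<le> l2_norm M g"
    using strictly_positive_bounded_below[OF TL2] * by blast
  have kernel: "AE x in M. f x = 0" if "(f, \<lambda>_. 0) \<in> l2_adjoint M T" for f
    using that * l2_adjoint_subset[of M T]
    by (intro ae_constant_L2_AE_zero) (auto simp: l2_liouville_def l2_kernel_def)
  have "(g, h) \<in> l2_closure M T" if gh: "(g, h) \<in> l2_adjoint M T" for g h
  proof -
    have g: "g \<in> L2 M" and h: "h \<in> L2 M"
      using gh l2_adjoint_subset[of M T] by auto
    have "l2_operator M T"
      using assms(1) by (simp add: symmetric_operator_def)
    then obtain f k where fk: "(f, k) \<in> l2_closure M T"
      and hk: "(\<lambda>x. h x - k x, \<lambda>_. 0) \<in> l2_adjoint M T"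
      using closure_range_projection[OF _ C h] by blast
    have h_eq: "AE x in M. h x = k x"
      using kernel[OF hk] by simp
    have f: "f \<in> L2 M"
      using fk closure_sub l2_adjoint_subset[of M T] by auto
    \<comment> \<open>Since \<open>h\<close> and \<open>k\<close> agree only almost everywhere,
      \<open>k\<close> is replaced by \<open>h\<close>; the second components then cancel exactly in
      the difference with \<open>(g, h)\<close>.\<close>
    have fh: "(f, h) \<in> l2_closure M T"
      using l2_adjoint_cong_AE[OF l2_adjoint_subset fk[unfolded l2_closure_def] f h] h_eq
      by (simp add: l2_closure_def)
    then have "(\<lambda>x. g x - f x, \<lambda>_. 0) \<in> l2_adjoint M T"
      using l2_adjoint_diff[OF TL2 gh] closure_sub by fastforce
    then have "AE x in M. g x = f x"
      using kernel by fastforce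
    then show ?thesis
      using l2_adjoint_cong_AE[OF l2_adjoint_subset fh[unfolded l2_closure_def] g h]
      by (simp add: l2_closure_def)
  qed
  then show "essentially_self_adjoint M T"
    using closure_sub unfolding essentially_self_adjoint_iff[OF assms(1)] by auto
qed

end
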